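(* Let $p\ge11$ be prime, let $q_p=e^{2\pi i/p}$, and put $r=\lfloor (p+1)/4\rfloor$. Then the second coordinate of $U_r^{(r)}(q_p)$ is nonzero and $$\frac{\bigl(U_r^{(r)}(q_p)\bigr)_1}{\bigl(U_r^{(r)}(q_p)\bigr)_2}=E_{(p-1)/2}(q_p).$$
   Context: Put $[n]_q=\frac{1-q^n}{1-q}=1+q+\dots+q^{n-1}$ for $n\ge1$, $[m]_q!=\prod_{j=1}^m[j]_q$, $[0]_q!=1$. For $a\in\mathbb Z$ put $\langle a\rangle_q=[a]_q$ if $a>0$, $\langle 0\rangle_q=0$, and $\langle a\rangle_q=-[-a]_q$ if $a<0$. For $m\ge0$ put $$E_m(q)=\sum_{n=1}^m\frac{(-1)^{n-1}q^{2n}}{[n]_q^3},\qquad h_m(q)=\frac{[m]_q!^2\,[2m]_q!}{[2]_q^{3m}}.$$ For $k,m\ge0$ put $$T_m^{(k)}(q)=\frac{\langle2\rangle_q}{\langle 2m-2k-1\rangle_q},$$ $$\rho_m^{(k)}(q)=\frac{\langle m-2k-2\rangle_q\langle 2m+2k+1\rangle_q}{\langle2\rangle_q^2}\left(\langle m\rangle_q\langle m-2k-2\rangle_q+\langle 2k+2\rangle_q^2\right).$$ The pairs $U_m^{(k)}(q)\in\mathbb Q(q)^2$ of rational functions are defined for $k,m\ge0$ by $U_m^{(0)}(q)=h_m(q)\bigl(E_m(q),1\bigr)$ and $$U_m^{(k+1)}(q)=T_m^{(k)}(q)\left(U_{m+1}^{(k)}(q)+\rho_{m+1}^{(k)}(q)\,U_m^{(k)}(q)\right).$$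 Subscripts $1,2$ on a pair denote its first and second coordinate, and $U_m^{(k)}(q_p)$ is the value of the rational functions at $q=q_p$. *)

theory Defs
  imports
    "HOL-Computational_Algebra.Computational_Algebra"
    "HOL-Computational_Algebra.Field_as_Ring"
begin

text \<open>
  Elements of \<open>\<rat>(q)\<close> are of type \<open>rat poly fract\<close>. The \<open>q\<close>-expressions below take \<open>q\<close> as an
  argument from an arbitrary field; the rational functions themselves are obtained by
  instantiating it with the indeterminate \<open>qvar\<close>.
\<close>

definition qvar :: "rat poly fract" where
  "qvar = to_fract [:0, 1:]"

text \<open>
  The pair \<open>quot_of_fract f\<close> is numerator and denominator of \<open>f\<close> in lowest terms, so \<open>f\<close> has a
  value at \<open>z\<close> iff this denominator does not vanish at \<open>z\<close>. (At a pole \<open>ratfun_eval\<close> returns the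
  meaningless value 0.)
\<close>

definition ratfun_regular_at :: "rat poly fract \<Rightarrow> complex \<Rightarrow> bool" where
  "ratfun_regular_at f z \<longleftrightarrow> poly (map_poly of_rat (snd (quot_of_fract f))) z \<noteq> 0"

definition ratfun_eval :: "rat poly fract \<Rightarrow> complex \<Rightarrow> complex" where
  "ratfun_eval f z =
     poly (map_poly of_rat (fst (quot_of_fract f))) z /
     poly (map_poly of_rat (snd (quot_of_fract f))) z"

definition qnat :: "'a::field \<Rightarrow> nat \<Rightarrow> 'a" where
  "qnat q n = (\<Sum>i<n. q ^ i)"

definition qfact :: "'a::field \<Rightarrow> nat \<Rightarrow> 'a" where
  "qfact q m = (\<Prod>j=1..m. qnat q j)"

definition qangle :: "'a::field \<Rightarrow> int \<Rightarrow> 'a" where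
  "qangle q a =
     (if a > 0 then qnat q (nat a) else if a = 0 then 0 else - qnat q (nat (- a)))"

definition qE :: "'a::field \<Rightarrow> nat \<Rightarrow> 'a" where
  "qE q m = (\<Sum>n=1..m. (- 1) ^ (n - 1) * q ^ (2 * n) / qnat q n ^ 3)"

definition qh :: "'a::field \<Rightarrow> nat \<Rightarrow> 'a" where
  "qh q m = qfact q m ^ 2 * qfact q (2 * m) / qnat q 2 ^ (3 * m)"

text \<open>
  In \<open>qT\<close>, \<open>qrho\<close> and \<open>qU\<close> the superscript \<open>k\<close> precedes the subscript \<open>m\<close>, e.g.
  \<open>qU q k m\<close> is \<open>U\<^sub>m\<^sup>(\<^sup>k\<^sup>)(q)\<close>.
\<close>

definition qT :: "'a::field \<Rightarrow> nat \<Rightarrow> nat \<Rightarrow> 'a" where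
  "qT q k m = qangle q 2 / qangle q (2 * int m - 2 * int k - 1)"

definition qrho :: "'a::field \<Rightarrow> nat \<Rightarrow> nat \<Rightarrow> 'a" where
  "qrho q k m =
     qangle q (int m - 2 * int k - 2) * qangle q (2 * int m + 2 * int k + 1) / qangle q 2 ^ 2 *
     (qangle q (int m) * qangle q (int m - 2 * int k - 2) + qangle q (2 * int k + 2) ^ 2)"

fun qU :: "'a::field \<Rightarrow> nat \<Rightarrow> nat \<Rightarrow> 'a \<times> 'a" where
  "qU q 0 m = (qh q m * qE q m, qh q m)"
| "qU q (Suc k) m =
     (qT q k m * (fst (qU q k (Suc m)) + qrho q k (Suc m) * fst (qU q k m)),
      qT q k m * (snd (qU q k (Suc m)) + qrho q k (Suc m) * snd (qU q k m)))"

end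

theory Submission
  imports Defs
begin

text \<open>
  Let \<open>M = (p - 1) / 2\<close> and \<open>z = q\<^sub>p\<close>. If \<open>m + k + 1 = M\<close>, then \<open>\<rho>\<^sub>m\<^sub>+\<^sub>1\<close> at level \<open>k\<close> contains the factor
  \<open>[2 M + 1] = [p]\<close>, which vanishes at \<open>z\<close>. So along the antidiagonal \<open>m + k = M\<close> the recursion only
  multiplies by \<open>T\<close>, and all pairs there are multiples of \<open>U\<^sub>M\<close> at level 0, that is, of \<open>(E\<^sub>M, 1)\<close>. The
  next antidiagonal \<open>m + k = M + 1\<close> starts with \<open>h\<^sub>M\<^sub>+\<^sub>1(z) = 0\<close>, so its pairs are multiples of
  \<open>(E\<^sub>M, 1)\<close> as well. The pair at \<open>m = k = r\<close> lies on the first of these antidiagonals if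
  \<open>p \<equiv> 1 (mod 4)\<close> and on the second if \<open>p \<equiv> 3 (mod 4)\<close>.

  It remains to see that the scalar factor is not zero. It is a \<open>p\<close>-integral element of \<open>\<rat>(z)\<close>, and
  its reduction modulo the prime above \<open>p\<close> is computed by putting \<open>z = 1\<close>: there the recursion has the
  closed-form solutions \<open>dcoeff\<close> and \<open>wcoeff\<close> below. The second one is, up to units,
  \<open>r (2 r + 1) (12 r\<^sup>2 + 1)\<close> at \<open>r = (p + 1) / 4\<close>, and there \<open>4 (12 r\<^sup>2 + 1) \<equiv> 7 (mod p)\<close>.
\<close>

section \<open>Evaluation of integer polynomials at complex points\<close>

lemma poly_map_poly_mult:
  fixes f :: "'a::comm_ring_1 \<Rightarrow> 'b::comm_ring_1"
  assumes "f 0 = 0" and "\<And>x y. f (x + y) = f x + f y" and "\<And>x y. f (x * y) = f x * f y"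
  shows "poly (map_poly f (A * B)) x = poly (map_poly f A) x * poly (map_poly f B) x"
proof -
  have add: "map_poly f (P + Q) = map_poly f P + map_poly f Q" for P Q
    by (intro poly_eqI) (simp add: coeff_map_poly assms)
  have smult: "map_poly f (smult c P) = smult (f c) (map_poly f P)" for c P
    by (intro poly_eqI) (simp add: coeff_map_poly assms)
  show ?thesis
    by (induction A) (simp_all add: add smult map_poly_pCons assms algebra_simps)
qed

abbreviation int_poly_at :: "int poly \<Rightarrow> complex \<Rightarrow> complex" where
  "int_poly_at A x \<equiv> poly (map_poly of_int A) x"

lemma int_poly_at_simps:
  "int_poly_at (pCons a A) x = of_int a + x * int_poly_at A x"
  "int_poly_at (A + B) x = int_poly_at A x + int_poly_at B x"
  "int_poly_at (A - B) x = int_poly_at A x - int_poly_at B x"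
  "int_poly_at (- A) x = - int_poly_at A x"
  "int_poly_at (smult c A) x = of_int c * int_poly_at A x"
  "int_poly_at (A * B) x = int_poly_at A x * int_poly_at B x"
  "int_poly_at (monom c n) x = of_int c * x ^ n"
proof -
  have "map_poly (of_int :: int \<Rightarrow> complex) (A + B) = map_poly of_int A + map_poly of_int B"
    "map_poly (of_int :: int \<Rightarrow> complex) (A - B) = map_poly of_int A - map_poly of_int B"
    "map_poly (of_int :: int \<Rightarrow> complex) (- A) = - map_poly of_int A"
    "map_poly (of_int :: int \<Rightarrow> complex) (smult c A) = smult (of_int c) (map_poly of_int A)"
    by (auto intro!: poly_eqI simp: coeff_map_poly)
  then show "int_poly_at (A + B) x = int_poly_at A x + int_poly_at B x"
    "int_poly_at (A - B) x = int_poly_at A x - int_poly_at B x"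
    "int_poly_at (- A) x = - int_poly_at A x"
    "int_poly_at (smult c A) x = of_int c * int_poly_at A x"
    by simp_all
  show "int_poly_at (pCons a A) x = of_int a + x * int_poly_at A x"
    by (simp add: map_poly_pCons)
  show "int_poly_at (A * B) x = int_poly_at A x * int_poly_at B x"
    by (rule poly_map_poly_mult) auto
  show "int_poly_at (monom c n) x = of_int c * x ^ n"
    by (simp add: map_poly_monom poly_monom)
qed

lemma int_poly_at_power: "int_poly_at (A ^ n) x = int_poly_at A x ^ n"
  by (induction n) (simp_all add: int_poly_at_simps)

lemma int_poly_at_cnj: "int_poly_at A (cnj x) = cnj (int_poly_at A x)"
  by (induction A) (simp_all add: int_poly_at_simps)

lemma int_poly_at_reflect:
  assumes "x \<noteq> 0"
  shows "int_poly_at (reflect_poly A) x = x ^ degree A * int_poly_at A (inverse x)"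
proof -
  have "degree (map_poly (of_int :: int \<Rightarrow> complex) A) = degree A"
    by (intro degree_map_poly) auto
  then have "map_poly (of_int :: int \<Rightarrow> complex) (reflect_poly A) = reflect_poly (map_poly of_int A)"
    by (intro poly_eqI) (simp add: coeff_map_poly coeff_reflect_poly)
  with assms show ?thesis
    by (simp add: poly_reflect_poly_nz degree_map_poly)
qed

text \<open>The inner binomial coefficients are divisible by \<open>p\<close>. At \<open>z\<close>,
  where \<open>z ^ p = 1\<close>, this makes \<open>(z - 1) ^ p\<close> equal to \<open>p\<close>
  times an integer polynomial in \<open>z\<close>.\<close>

lemma power_prime_diff_one:
  fixes p :: nat
  assumes "prime p" and "odd p"
  obtains H :: "int poly" where "[:-1, 1:] ^ p = monom 1 p - 1 + smult (int p) H"
proof -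
  let ?t = "\<lambda>k. of_nat (p choose k) * (monom 1 1) ^ k * (-1) ^ (p - k) :: int poly"
  have p: "p > 0" using assms by (simp add: prime_gt_0_nat)
  have "[:-1, 1:] = monom 1 1 + (-1 :: int poly)"
    by (simp add: monom_Suc one_pCons)
  then have "[:-1, 1:] ^ p = (\<Sum>k\<le>p. ?t k)"
    by (simp only: binomial_ring)
  also have "{..p} = insert 0 (insert p {1..<p})" using p by auto
  also have "sum ?t \<dots> = -1 + (monom 1 p + sum ?t {1..<p})"
    using p assms(2) by (simp add: monom_power)
  finally have eq: "[:-1, 1:] ^ p = -1 + (monom 1 p + sum ?t {1..<p})" .
  have "[:int p:] dvd sum ?t {1..<p}"
  proof (intro dvd_sum)
    fix k assume "k \<in> {1..<p}"
    then have "p dvd (p choose k)" using assms by (intro dvd_choose_prime) auto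
    then obtain c where "p choose k = p * c" by blast
    then have "?t k = [:int p:] * (of_nat c * (monom 1 1) ^ k * (-1) ^ (p - k))"
      by (simp add: of_nat_poly mult_smult_left del: mult_pCons_left)
    then show "[:int p:] dvd ?t k" by (rule dvdI)
  qed
  then obtain H where "sum ?t {1..<p} = [:int p:] * H" by blast
  then show ?thesis using eq that[of H] by simp
qed

section \<open>The root of unity \<open>z\<close> and integer polynomials that vanish there\<close>

locale prime_root_of_unity =
  fixes p :: nat and z :: complex
  assumes prime: "prime p" and odd: "odd p"
    and z_def: "z = exp (2 * complex_of_real pi * \<i> / of_nat p)"
begin

lemma p_gt_2: "p > 2"
  using prime odd prime_ge_2_nat[of p] by (cases "p = 2") auto

lemma z_power [simp]: "z ^ p = 1"
proof -
  have "z ^ p = exp (of_nat p * (2 * complex_of_real pi * \<i> / of_nat p))"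
    unfolding z_def by (simp only: exp_of_nat_mult)
  also have "of_nat p * (2 * complex_of_real pi * \<i> / of_nat p) = 2 * complex_of_real pi * \<i>"
    using p_gt_2 by simp
  finally show ?thesis by simp
qed

lemma z_nonzero [simp]: "z \<noteq> 0"
  by (simp add: z_def)

lemma norm_z: "norm z = 1"
  by (simp add: z_def)

lemma z_neq_1 [simp]: "z \<noteq> 1"
proof
  assume "z = 1"
  moreover have "z = cis (2 * pi / real p)"
    by (simp add: z_def cis_conv_exp mult_ac)
  ultimately have "sin (2 * pi / real p) = 0" by (simp add: complex_eq_iff)
  moreover have "sin (2 * pi / real p) > 0"
    using p_gt_2 by (intro sin_gt_zero) (auto simp: field_simps)
  ultimately show False by simp
qed

text \<open>
  If \<open>A(1)\<close> were prime to \<open>p\<close>, then \<open>p\<close> would be invertible in \<open>\<int>[z]\<close> up to an integer prime to \<open>p\<close>, because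
  \<open>(z - 1)\<^sup>p\<close> is a multiple of \<open>p\<close>. Reducing this relation by a polynomial \<open>f\<close> that has minimal degree
  among those with root \<open>z\<close> and leading coefficient prime to \<open>p\<close> yields a polynomial \<open>g\<close> of smaller
  degree with root \<open>z\<close> and constant coefficient prime to \<open>p\<close>. Its reciprocal polynomial has the
  root \<open>1/z\<close>, hence also the conjugate \<open>z\<close>, which contradicts the choice of \<open>f\<close>.
\<close>

lemma root_imp_dvd_eval_1:
  assumes A: "int_poly_at A z = 0"
  shows "int p dvd poly A 1"
proof (rule ccontr)
  assume ndvd: "\<not> int p dvd poly A 1"
  have prime_int: "prime (int p)" using prime by simp
  define c where "c = poly A 1"
  obtain H :: "int poly" where H: "[:-1, 1:] ^ p = monom 1 p - 1 + smult (int p) H"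
    using power_prime_diff_one[OF prime odd] .
  define Y where "Y = synthetic_div A 1"
  have "A = [:-1, 1:] * Y + [:c:]"
    using synthetic_div_correct'[of 1 A] by (simp add: Y_def c_def)
  from arg_cong[OF this, of "\<lambda>P. int_poly_at P z"] A
  have "(z - 1) * int_poly_at Y z = - of_int c"
    by (simp add: int_poly_at_simps algebra_simps eq_neg_iff_add_eq_0)
  then have "(z - 1) ^ p * int_poly_at Y z ^ p = - of_int (c ^ p)"
    using odd by (simp flip: power_mult_distrib)
  moreover have "(z - 1) ^ p = of_nat p * int_poly_at H z"
  proof -
    have "(z - 1) ^ p = int_poly_at ([:-1, 1:] ^ p) z"
      by (simp add: int_poly_at_power int_poly_at_simps)
    then show ?thesis
      unfolding H by (simp add: int_poly_at_simps one_pCons)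
  qed
  ultimately have unit: "of_int (c ^ p) + of_nat p * int_poly_at (H * Y ^ p) z = 0"
    by (simp add: int_poly_at_simps int_poly_at_power algebra_simps)
  have c_ndvd: "\<not> int p dvd c ^ p"
    using ndvd prime_dvd_power[OF prime_int] by (auto simp: c_def)

  define K where "K f \<longleftrightarrow> int_poly_at f z = 0 \<and> \<not> int p dvd lead_coeff f" for f
  \<comment> \<open>This polynomial is \<open>X ^ p - 1\<close>, so candidates for \<open>f\<close>
    exist.\<close>
  have "K (pCons (-1) (monom 1 (p - 1)))"
    using p_gt_2 z_power power_eq_if[of z p]
    by (auto simp: K_def int_poly_at_simps degree_monom_eq monom_eq_0_iff coeff_pCons split: nat.splits)
  from ex_has_least_nat[of K, OF this, of degree]
  obtain f where f: "K f" and f_min: "\<And>g. K g \<Longrightarrow> degree f \<le> degree g" by blast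
  have f0: "f \<noteq> 0" using f by (auto simp: K_def)
  have deg: "degree f > 0"
  proof (rule ccontr)
    assume "\<not> degree f > 0"
    then obtain a where "f = [:a:]" using degree_0_id[of f] by (metis gr0I degree_0_id)
    with f show False by (auto simp: K_def int_poly_at_simps)
  qed

  \<comment> \<open>\<open>f\<close> need not be monic, so only pseudo-division is possible over the
    integers. It costs the factor \<open>b\<close>, a power of the leading coefficient of
    \<open>f\<close> and hence prime to \<open>p\<close>.\<close>
  obtain Q R where QR: "pseudo_divmod (H * Y ^ p) f = (Q, R)" by force
  define b where "b = coeff f (degree f) ^ (Suc (degree (H * Y ^ p)) - degree f)"
  have bQR: "smult b (H * Y ^ p) = f * Q + R" and R: "R = 0 \<or> degree R < degree f"
    using pseudo_divmod[OF f0 QR] unfolding b_def by blast+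
  have b_ndvd: "\<not> int p dvd b"
    using f prime_dvd_power[OF prime_int] by (auto simp: b_def K_def)
  from arg_cong[OF bQR, of "\<lambda>P. int_poly_at P z"] f
  have R_z: "of_int b * int_poly_at (H * Y ^ p) z = int_poly_at R z"
    by (simp add: int_poly_at_simps K_def)

  \<comment> \<open>This is \<open>b\<close> times the relation \<open>unit\<close>, with
    \<open>b * H * Y ^ p\<close> replaced by its remainder \<open>R\<close>.\<close>
  define g where "g = [:b * c ^ p:] + smult (int p) R"
  have "int_poly_at g z = of_int b * (of_int (c ^ p) + of_nat p * int_poly_at (H * Y ^ p) z)"
    by (simp add: g_def int_poly_at_simps R_z[symmetric] algebra_simps)
  then have g_z: "int_poly_at g z = 0" by (simp only: unit mult_zero_right)
  have deg_g: "degree g < degree f"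
    using R deg unfolding g_def by (intro degree_add_less) auto
  have g_0: "\<not> int p dvd coeff g 0"
    using b_ndvd c_ndvd prime_dvd_mult_iff[OF prime_int]
    by (simp add: g_def dvd_add_left_iff)
  have "int_poly_at (reflect_poly g) (inverse z) = 0"
    using g_z by (simp add: int_poly_at_reflect)
  moreover have "inverse z = cnj z"
    using norm_z by (simp add: inverse_complex_def complex_norm_square[symmetric] complex_eq_iff cmod_def)
  ultimately have "int_poly_at (reflect_poly g) z = 0"
    by (simp add: int_poly_at_cnj)
  moreover have "lead_coeff (reflect_poly g) = coeff g 0"
    using g_0 by (cases "coeff g 0 = 0") (auto simp: coeff_reflect_poly)
  ultimately have "K (reflect_poly g)" using g_0 by (simp add: K_def)
  from f_min[OF this] degree_reflect_poly_le[of g] deg_g show False by linarith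
qed


section \<open>Reduction modulo the prime above \<open>p\<close>\<close>

lemma int_prime: "prime (int p)"
  using prime by simp

lemma not_dvd_2_power: "\<not> int p dvd 2 ^ k"
proof
  assume "int p dvd 2 ^ k"
  then have "int p dvd 2" by (rule prime_dvd_power[OF int_prime])
  then show False using p_gt_2 by (auto dest: zdvd_imp_le)
qed

text \<open>These are the units of the localisation of the integers at \<open>p\<close>.\<close>

definition p_unit :: "rat \<Rightarrow> bool" where
  "p_unit a \<longleftrightarrow> (\<exists>x y. \<not> int p dvd x \<and> \<not> int p dvd y \<and> a = of_int x / of_int y)"

text \<open>
  \<open>reduces c a\<close> makes precise that \<open>c\<close>, as a rational function of \<open>z\<close>, becomes \<open>a\<close> at \<open>z = 1\<close>.
  The number \<open>a\<close> is determined by \<open>c\<close> only modulo \<open>p\<close>, since \<open>0 = 1 + z + \<dots> + z\<^sup>p\<^sup>-\<^sup>1\<close>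
  reduces to \<open>p\<close>.
\<close>

definition reduces :: "complex \<Rightarrow> rat \<Rightarrow> bool" where
  "reduces c a \<longleftrightarrow> (\<exists>A B. \<not> int p dvd poly B 1 \<and> c = int_poly_at A z / int_poly_at B z \<and>
     a = of_int (poly A 1) / of_int (poly B 1))"

text \<open>A denominator whose value at 1 is prime to \<open>p\<close> cannot vanish at
  \<open>z\<close>, by \<open>root_imp_dvd_eval_1\<close>.\<close>

lemma reducesE:
  assumes "reduces c a"
  obtains A B where "\<not> int p dvd poly B 1" "int_poly_at B z \<noteq> 0" "poly B 1 \<noteq> 0"
    "c = int_poly_at A z / int_poly_at B z" "a = of_int (poly A 1) / of_int (poly B 1)"
  using assms root_imp_dvd_eval_1 unfolding reduces_def by (metis dvd_0_right)

lemma reduces_int_poly: "reduces (int_poly_at A z) (of_int (poly A 1))"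
  unfolding reduces_def
  by (rule exI[of _ A], rule exI[of _ 1]) (use p_gt_2 in \<open>auto simp: one_pCons int_poly_at_simps\<close>)

lemma reduces_of_int: "reduces (of_int n) (of_int n)"
  using reduces_int_poly[of "[:n:]"] by (simp add: int_poly_at_simps)

lemma reduces_add:
  assumes "reduces c a" and "reduces d b"
  shows "reduces (c + d) (a + b)"
proof -
  from assms obtain A B A' B'
    where *: "\<not> int p dvd poly B 1" "int_poly_at B z \<noteq> 0" "poly B 1 \<noteq> 0"
      "c = int_poly_at A z / int_poly_at B z" "a = of_int (poly A 1) / of_int (poly B 1)"
      "\<not> int p dvd poly B' 1" "int_poly_at B' z \<noteq> 0" "poly B' 1 \<noteq> 0"
      "d = int_poly_at A' z / int_poly_at B' z" "b = of_int (poly A' 1) / of_int (poly B' 1)"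
    by (elim reducesE) blast
  show ?thesis
    unfolding reduces_def
    by (rule exI[of _ "A * B' + A' * B"], rule exI[of _ "B * B'"])
      (use * in \<open>simp add: int_poly_at_simps prime_dvd_mult_iff[OF int_prime] add_frac_eq\<close>)
qed

lemma reduces_mult:
  assumes "reduces c a" and "reduces d b"
  shows "reduces (c * d) (a * b)"
proof -
  from assms obtain A B A' B'
    where *: "\<not> int p dvd poly B 1" "c = int_poly_at A z / int_poly_at B z"
      "a = of_int (poly A 1) / of_int (poly B 1)"
      "\<not> int p dvd poly B' 1" "d = int_poly_at A' z / int_poly_at B' z"
      "b = of_int (poly A' 1) / of_int (poly B' 1)"
    by (elim reducesE) blast
  show ?thesis
    unfolding reduces_def
    by (rule exI[of _ "A * A'"], rule exI[of _ "B * B'"])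
      (use * in \<open>simp add: int_poly_at_simps prime_dvd_mult_iff[OF int_prime]\<close>)
qed

lemma reduces_minus: "reduces c a \<Longrightarrow> reduces (- c) (- a)"
  using reduces_mult[OF reduces_of_int[of "-1"]] by fastforce

text \<open>If \<open>d\<close> is represented by \<open>A / B\<close> and \<open>b\<close> is a
  unit, then \<open>p\<close> does not divide \<open>poly A 1\<close>, so \<open>B / A\<close>
  represents \<open>1 / d\<close>.\<close>

lemma reduces_divide:
  assumes "reduces c a" and "reduces d b" and "p_unit b"
  shows "reduces (c / d) (a / b)"
proof -
  from assms(2) obtain A B
    where *: "\<not> int p dvd poly B 1" "poly B 1 \<noteq> 0"
      "d = int_poly_at A z / int_poly_at B z" "b = of_int (poly A 1) / of_int (poly B 1)"
    by (elim reducesE)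
  from assms(3) obtain x y where xy: "\<not> int p dvd x" "\<not> int p dvd y" "b = of_int x / of_int y"
    by (auto simp: p_unit_def)
  then have "of_int (poly A 1) * (of_int y :: rat) = of_int x * of_int (poly B 1)"
    using * by (auto simp: field_simps)
  then have "poly A 1 * y = x * poly B 1"
    by (simp flip: of_int_mult)
  then have "\<not> int p dvd poly A 1"
    using xy * prime_dvd_mult_iff[OF int_prime] by (metis dvd_mult2)
  then have "reduces (1 / d) (1 / b)"
    unfolding reduces_def by (intro exI[of _ B] exI[of _ A]) (simp add: *)
  from reduces_mult[OF assms(1) this] show ?thesis by simp
qed

lemma reduces_nonzero:
  assumes "reduces c a" and "p_unit a"
  shows "c \<noteq> 0"
proof
  assume "c = 0"
  moreover from assms(2) have "a \<noteq> 0" by (auto simp: p_unit_def)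
  \<comment> \<open>Here \<open>c / c\<close> is \<open>0 / 0\<close>, which is 0 by convention,
    whereas \<open>a / a = 1\<close>.\<close>
  ultimately have "reduces 0 1"
    using reduces_divide[OF assms(1) assms(1) assms(2)] by simp
  then obtain A B where *: "\<not> int p dvd poly B 1" "int_poly_at B z \<noteq> 0" "poly B 1 \<noteq> 0"
    "0 = int_poly_at A z / int_poly_at B z" "1 = (of_int (poly A 1) / of_int (poly B 1) :: rat)"
    by (elim reducesE)
  then show False using root_imp_dvd_eval_1[of A] by simp
qed

section \<open>q-numbers at \<open>z\<close> and their reductions\<close>

lemma qnat_p: "qnat z p = 0"
proof -
  have "(z - 1) * qnat z p = 0"
    using power_diff_1_eq[of z p] by (simp add: qnat_def)
  then show ?thesis by simp
qed

lemma reduces_qnat: "reduces (qnat z n) (of_nat n)"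
proof -
  have "int_poly_at (\<Sum>i<n. monom 1 i) z = qnat z n"
    by (induction n) (simp_all add: int_poly_at_simps qnat_def)
  moreover have "poly (\<Sum>i<n. monom 1 i) 1 = int n"
    by (simp add: poly_sum poly_monom)
  ultimately show ?thesis
    using reduces_int_poly[of "\<Sum>i<n. monom 1 i"] by simp
qed

text \<open>Adding \<open>qnat z p * d\<close> leaves \<open>c\<close> unchanged, since
  \<open>qnat z p = 0\<close>, but changes the reduction by \<open>p * x\<close>.\<close>

lemma reduces_cong:
  assumes "reduces c a" and "reduces d x" and "b = a + of_nat p * x"
  shows "reduces c b"
  using reduces_add[OF assms(1) reduces_mult[OF reduces_qnat[of p] assms(2)]]
  by (simp add: qnat_p assms(3))

lemma p_unit_of_int: "\<not> int p dvd n \<Longrightarrow> p_unit (of_int n)"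
  unfolding p_unit_def using p_gt_2 by (intro exI[of _ n] exI[of _ 1]) auto

lemma qangle_minus: "qangle q (- n) = - qangle q n"
  by (simp add: qangle_def)

lemma reduces_qangle: "reduces (qangle z n) (of_int n)"
proof -
  have "reduces (qangle z (int m)) (of_int (int m))" for m
    using reduces_qnat[of m] reduces_of_int[of 0] by (simp add: qangle_def)
  note * = this
  show ?thesis
  proof (cases "n \<ge> 0")
    case True
    with *[of "nat n"] show ?thesis by simp
  next
    case False
    with reduces_minus[OF *[of "nat (- n)"]] show ?thesis by (simp add: qangle_minus)
  qed
qed

text \<open>Indices near \<open>M = (p - 1) / 2\<close> become half-integers modulo
  \<open>p\<close>; this removes \<open>M\<close> from the reduced recursion.\<close>

lemma reduces_qangle_half:
  assumes "2 * n = m + int p * j"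
  shows "reduces (qangle z n) (of_int m / 2)"
proof (rule reduces_cong)
  have "p_unit (of_int 2)"
    using not_dvd_2_power[of 1] by (intro p_unit_of_int) simp
  from reduces_divide[OF reduces_of_int[of "- j"] reduces_of_int this]
  show "reduces (of_int (- j) / of_int 2) (of_int (- j) / of_int 2)" .
  have "of_int m = (of_int (2 * n - int p * j) :: rat)" using assms by simp
  then show "of_int m / 2 = of_int n + of_nat p * (of_int (- j) / of_int 2 :: rat)"
    by (simp add: field_simps)
qed (rule reduces_qangle)

lemma reduces_qangle_cong:
  assumes "n = m + int p * j"
  shows "reduces (qangle z n) (of_int m)"
  using reduces_qangle_half[of n "2 * m" "2 * j"] assms by simp

lemma qnat_nonzero:
  assumes "0 < n" and "n < p"
  shows "qnat z n \<noteq> 0"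
proof (rule reduces_nonzero[OF reduces_qnat])
  have "\<not> int p dvd int n" using assms by (auto dest: dvd_imp_le)
  then show "p_unit (of_nat n)" using p_unit_of_int[of "int n"] by simp
qed

lemma qangle_nonzero: "a \<noteq> 0 \<Longrightarrow> \<bar>a\<bar> < int p \<Longrightarrow> qangle z a \<noteq> 0"
  by (auto simp: qangle_def qnat_nonzero)

lemma qfact_nonzero: "n < p \<Longrightarrow> qfact z n \<noteq> 0"
  by (auto simp: qfact_def qnat_nonzero)

lemma qh_nonzero: "2 * m < p \<Longrightarrow> qh z m \<noteq> 0"
  using p_gt_2 by (auto simp: qh_def qfact_nonzero qnat_nonzero)

lemma qh_eq_0:
  assumes "p \<le> 2 * m"
  shows "qh z m = 0"
proof -
  have "qfact z (2 * m) = 0"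
    using assms p_gt_2 qnat_p unfolding qfact_def by (intro prod_zero) auto
  then show ?thesis by (simp add: qh_def)
qed

section \<open>Closed-form solutions of the reduced recursion\<close>

definition dcoeff :: "nat \<Rightarrow> rat" where
  "dcoeff k = (-1) ^ k / (2 ^ k * fact k)"

definition wcoeff :: "nat \<Rightarrow> rat" where
  "wcoeff k = - of_nat (k * (2 * k + 1) * (12 * k ^ 2 + 1)) / 8 * dcoeff k"

lemma not_dvd_denom:
  assumes "k < p"
  shows "\<not> int p dvd 2 ^ k * fact k"
proof
  assume "int p dvd 2 ^ k * fact k"
  then have "int p dvd 2 ^ k \<or> int p dvd int (fact k)"
    using prime_dvd_mult_iff[OF int_prime] by simp
  then have "p dvd fact k" using not_dvd_2_power int_dvd_int_iff by blast
  with prime_dvd_fact_iff[OF prime] assms show False by simp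
qed

lemma p_unit_dcoeff: "k < p \<Longrightarrow> p_unit (dcoeff k)"
  unfolding p_unit_def dcoeff_def
  using not_dvd_denom[of k] prime_dvd_power[OF int_prime, of "-1" k] p_gt_2
  by (intro exI[of _ "(-1) ^ k"] exI[of _ "2 ^ k * fact k"]) auto

lemma p_unit_wcoeff:
  assumes "p \<ge> 11" and "4 * r = p + 1"
  shows "p_unit (wcoeff r)"
proof -
  have "\<not> p dvd r" using assms by (auto dest!: dvd_imp_le)
  moreover have "\<not> p dvd 2 * r + 1" using assms by (auto dest!: dvd_imp_le)
  moreover have "\<not> p dvd 12 * r ^ 2 + 1"
  proof
    assume "p dvd 12 * r ^ 2 + 1"
    then have "p dvd 4 * (12 * r ^ 2 + 1)" by (rule dvd_mult)
    also have "4 * (12 * r ^ 2 + 1) = 3 * (4 * r) ^ 2 + 4" by (simp add: power2_eq_square)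
    also have "\<dots> = p * (3 * p + 6) + 7"
      unfolding assms(2) by (simp add: power2_eq_square algebra_simps)
    \<comment> \<open>The bound \<open>p \<ge> 11\<close> excludes \<open>p = 7\<close>, where
      \<open>r = 2\<close> and \<open>12 * r ^ 2 + 1 = 49\<close>.\<close>
    finally have "p dvd 7" by (simp add: dvd_add_right_iff)
    with assms(1) show False by (auto dest!: dvd_imp_le)
  qed
  moreover define n where "n = r * (2 * r + 1) * (12 * r ^ 2 + 1)"
  ultimately have "\<not> int p dvd int n"
    using prime_dvd_mult_iff[OF prime] int_dvd_int_iff by blast
  then have num: "\<not> int p dvd int n * (-1) ^ Suc r"
    by (cases "even r") simp_all
  have den: "\<not> int p dvd 8 * (2 ^ r * fact r)"
    using not_dvd_2_power[of 3] not_dvd_denom[of r] assms prime_dvd_mult_iff[OF int_prime] by auto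
  have "wcoeff r = of_int (int n * (-1) ^ Suc r) / of_int (8 * (2 ^ r * fact r))"
    unfolding wcoeff_def dcoeff_def n_def[symmetric] by simp
  with num den show ?thesis unfolding p_unit_def by blast
qed

text \<open>The factor is the reduction of \<open>qT z k m\<close> at \<open>m + k + 1 = M\<close>,
  because \<open>2 * M\<close> is -1 modulo \<open>p\<close>.\<close>

lemma dcoeff_Suc: "dcoeff (Suc k) = 2 / of_int (- 4 * int k - 4) * dcoeff k"
proof -
  have "of_nat k + 1 \<noteq> (0 :: rat)" by (metis of_nat_Suc of_nat_neq_0 add.commute)
  moreover from this have "- 4 * of_nat k - 4 \<noteq> (0 :: rat)" by (simp add: algebra_simps)
  ultimately show ?thesis
    by (simp add: dcoeff_def divide_simps) (simp add: algebra_simps)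
qed

text \<open>This is the recursion into the antidiagonal \<open>m + k = M + 1\<close> with every
  q-number replaced by its reduction. The \<open>dcoeff\<close> term comes from the neighbouring
  antidiagonal \<open>m + k = M\<close>.\<close>

lemma wcoeff_Suc:
  "wcoeff (Suc k) = 2 / of_int (- 4 * int k - 2) *
     (wcoeff k + (of_int (- 6 * int k - 3) / 2) * 2 / 2 ^ 2 *
       ((of_int (1 - 2 * int k) / 2) * (of_int (- 6 * int k - 3) / 2) + of_int (2 * int k + 2) ^ 2)
       * dcoeff k)"
proof -
  define x :: rat where "x = of_nat k"
  have x: "x \<ge> 0" by (simp add: x_def)
  \<comment> \<open>What remains of the polynomial factor of \<open>wcoeff (Suc k)\<close> without
    \<open>x + 1\<close>, which cancels against the denominator in
    \<open>dcoeff_Suc\<close>.\<close>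
  define P where "P = (2 * x + 3) * (12 * (x + 1) ^ 2 + 1)"
  have nz: "- 4 * x - 4 \<noteq> 0" "- 4 * x - 2 \<noteq> 0"
    using x by linarith+
  have inner: "- (x * (2 * x + 1) * (12 * x ^ 2 + 1)) / 8 + ((- 6 * x - 3) / 2) * 2 / 2 ^ 2 *
      (((1 - 2 * x) / 2) * ((- 6 * x - 3) / 2) + (2 * x + 2) ^ 2) = (- 4 * x - 2) * P / 32"
    unfolding P_def by algebra
  have "of_nat (Suc k * (2 * Suc k + 1) * (12 * Suc k ^ 2 + 1)) = (x + 1) * P"
    by (simp add: P_def x_def algebra_simps)
  then have "wcoeff (Suc k) = - ((x + 1) * P) / 8 * (2 / (- 4 * x - 4)) * dcoeff k"
    unfolding wcoeff_def dcoeff_Suc by (simp add: x_def)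
  also have "- ((x + 1) * P) / 8 * (2 / (- 4 * x - 4)) = P / 16"
    using nz(1) by (simp add: divide_simps) (simp add: algebra_simps)
  also have "P / 16 = 2 / (- 4 * x - 2) * ((- 4 * x - 2) * P / 32)"
    using nz(2) by simp
  finally have step: "wcoeff (Suc k) = 2 / (- 4 * x - 2) * ((- 4 * x - 2) * P / 32) * dcoeff k" .
  have conv: "of_int (- 4 * int k - 2) = - 4 * x - 2" "of_int (- 6 * int k - 3) = - 6 * x - 3"
    "of_int (1 - 2 * int k) = 1 - 2 * x" "of_int (2 * int k + 2) = 2 * x + 2"
    "wcoeff k = - (x * (2 * x + 1) * (12 * x ^ 2 + 1)) / 8 * dcoeff k"
    by (simp_all add: x_def wcoeff_def algebra_simps)
  show ?thesis
    unfolding conv step inner[symmetric] by (simp only: distrib_right mult.assoc)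
qed

section \<open>The recursion at \<open>z\<close> on the antidiagonals \<open>m + k = M\<close> and
  \<open>m + k = M + 1\<close>\<close>

lemma qU_diagonal:
  assumes M: "p = 2 * M + 1" and "4 * k \<le> p - 1"
  shows "\<exists>D. reduces D (dcoeff k) \<and>
    qU z k (M - k) = (D * fst (qU z 0 M), D * snd (qU z 0 M))"
  using assms(2)
proof (induction k)
  case 0
  have "reduces 1 1" using reduces_of_int[of 1] by simp
  then show ?case by (intro exI[of _ 1]) (simp add: dcoeff_def)
next
  case (Suc k)
  define m where "m = M - Suc k"
  have m: "M - k = Suc m" "M = m + k + 1" using Suc.prems M by (auto simp: m_def)
  from Suc obtain D where D: "reduces D (dcoeff k)"
    "qU z k (Suc m) = (D * fst (qU z 0 M), D * snd (qU z 0 M))"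
    unfolding m by auto
  have "2 * int (Suc m) + 2 * int k + 1 = int p" using M m by simp
  then have "qangle z (2 * int (Suc m) + 2 * int k + 1) = 0"
    using p_gt_2 by (simp add: qangle_def qnat_p)
  then have rho: "qrho z k (Suc m) = 0" by (simp add: qrho_def)
  \<comment> \<open>The bound on \<open>Suc k\<close> gives
    \<open>0 < 4 * k + 4 < p\<close>.\<close>
  have "\<not> int p dvd - 4 * int k - 4"
  proof
    assume "int p dvd - 4 * int k - 4"
    then have "int p dvd - (- 4 * int k - 4)" by (simp only: dvd_minus_iff)
    then show False using Suc.prems p_gt_2 by (auto dest!: zdvd_imp_le)
  qed
  moreover have "reduces (qangle z (2 * int m - 2 * int k - 1)) (of_int (- 4 * int k - 4))"
    by (rule reduces_qangle_cong[where j = 1]) (simp add: M m)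
  ultimately have "reduces (qT z k m) (2 / of_int (- 4 * int k - 4))"
    unfolding qT_def using reduces_divide[OF reduces_qangle[of 2]] p_unit_of_int by fastforce
  from reduces_mult[OF this D(1)] have "reduces (qT z k m * D) (dcoeff (Suc k))"
    by (simp add: dcoeff_Suc)
  moreover have "qU z (Suc k) m = (qT z k m * D * fst (qU z 0 M), qT z k m * D * snd (qU z 0 M))"
    by (simp add: D(2) rho del: qU.simps(1))
  ultimately show ?case unfolding m_def by blast
qed

lemma qU_superdiagonal:
  assumes M: "p = 2 * M + 1" and "4 * k \<le> p + 1"
  shows "\<exists>W. reduces W (wcoeff k) \<and>
    qU z k (M + 1 - k) = (W * fst (qU z 0 M), W * snd (qU z 0 M))"
  using assms(2)
proof (induction k)
  case 0
  have "qh z (Suc M) = 0" by (rule qh_eq_0) (simp add: M)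
  moreover have "reduces 0 0" using reduces_of_int[of 0] by simp
  ultimately show ?case by (intro exI[of _ 0]) (simp add: wcoeff_def)
next
  case (Suc k)
  define m where "m = M - k"
  have m: "M + 1 - k = Suc m" "M + 1 - Suc k = m" "M = m + k"
    using Suc.prems M by (auto simp: m_def)
  from Suc obtain W where W: "reduces W (wcoeff k)"
    "qU z k (Suc m) = (W * fst (qU z 0 M), W * snd (qU z 0 M))"
    unfolding m by auto
  \<comment> \<open>The second pair in the recursion, \<open>qU z k m\<close>, has
    \<open>m + k = M\<close> and so lies on the other antidiagonal.\<close>
  from qU_diagonal[OF M, of k] Suc.prems M obtain D where D: "reduces D (dcoeff k)"
    "qU z k m = (D * fst (qU z 0 M), D * snd (qU z 0 M))"
    unfolding m_def by auto
  have a1: "reduces (qangle z (int (Suc m) - 2 * int k - 2)) (of_int (- 6 * int k - 3) / 2)"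
    by (rule reduces_qangle_half[where j = 1]) (simp add: M m)
  have a2: "reduces (qangle z (2 * int (Suc m) + 2 * int k + 1)) 2"
    using reduces_qangle_cong[where n = "2 * int (Suc m) + 2 * int k + 1" and m = 2 and j = 1]
    by (simp add: M m)
  have a3: "reduces (qangle z (int (Suc m))) (of_int (1 - 2 * int k) / 2)"
    by (rule reduces_qangle_half[where j = 1]) (simp add: M m)
  have a4: "reduces (qangle z 2) 2"
    using reduces_qangle[of 2] by simp
  have unit: "p_unit (2 * 2)"
    using p_unit_of_int[OF not_dvd_2_power[of 2]] by simp
  have rho: "reduces (qrho z k (Suc m)) ((of_int (- 6 * int k - 3) / 2) * 2 / 2 ^ 2 *
      ((of_int (1 - 2 * int k) / 2) * (of_int (- 6 * int k - 3) / 2) + of_int (2 * int k + 2) ^ 2))"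
    unfolding qrho_def power2_eq_square
    by (rule reduces_mult[OF reduces_divide[OF reduces_mult[OF a1 a2] reduces_mult[OF a4 a4] unit]
      reduces_add[OF reduces_mult[OF a3 a1] reduces_mult[OF reduces_qangle reduces_qangle]]])
  have "\<not> int p dvd - 4 * int k - 2"
  proof
    assume "int p dvd - 4 * int k - 2"
    then have "int p dvd - (- 4 * int k - 2)" by (simp only: dvd_minus_iff)
    then show False using Suc.prems p_gt_2 by (auto dest!: zdvd_imp_le)
  qed
  moreover have "reduces (qangle z (2 * int m - 2 * int k - 1)) (of_int (- 4 * int k - 2))"
    by (rule reduces_qangle_cong[where j = 1]) (simp add: M m)
  ultimately have T: "reduces (qT z k m) (2 / of_int (- 4 * int k - 2))"
    unfolding qT_def using reduces_divide[OF reduces_qangle[of 2]] p_unit_of_int by fastforce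
  have "reduces (qT z k m * (W + qrho z k (Suc m) * D)) (wcoeff (Suc k))"
    unfolding wcoeff_Suc by (intro reduces_mult reduces_add T rho W(1) D(1))
  moreover have "qU z (Suc k) m =
      (qT z k m * (W + qrho z k (Suc m) * D) * fst (qU z 0 M),
       qT z k m * (W + qrho z k (Suc m) * D) * snd (qU z 0 M))"
    by (simp add: W(2) D(2) algebra_simps del: qU.simps(1))
  ultimately show ?case unfolding m(2) by blast
qed

end

section \<open>Values of rational functions at a complex point\<close>

abbreviation rat_poly_at :: "rat poly \<Rightarrow> complex \<Rightarrow> complex" where
  "rat_poly_at A x \<equiv> poly (map_poly of_rat A) x"

lemma rat_poly_at_mult: "rat_poly_at (A * B) x = rat_poly_at A x * rat_poly_at B x"
  by (rule poly_map_poly_mult) (auto simp: of_rat_add of_rat_mult)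

lemma rat_poly_at_add: "rat_poly_at (A + B) x = rat_poly_at A x + rat_poly_at B x"
proof -
  have "map_poly (of_rat :: rat \<Rightarrow> complex) (A + B) = map_poly of_rat A + map_poly of_rat B"
    by (auto intro!: poly_eqI simp: coeff_map_poly of_rat_add)
  then show ?thesis by simp
qed

text \<open>Any representing fraction is allowed, not only the one in lowest terms, so that closure
  under the field operations is immediate.\<close>

definition ratfun_value :: "complex \<Rightarrow> rat poly fract \<Rightarrow> complex \<Rightarrow> bool" where
  "ratfun_value x f c \<longleftrightarrow>
     (\<exists>A B. f = Fract A B \<and> rat_poly_at B x \<noteq> 0 \<and> c = rat_poly_at A x / rat_poly_at B x)"

text \<open>\<open>A\<close> and \<open>B\<close> differ from the lowest terms by a common factor
  \<open>d\<close>, which cannot vanish at \<open>x\<close> because \<open>B\<close> does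
  not.\<close>

lemma ratfun_value_eval:
  assumes "ratfun_value x f c"
  shows "ratfun_regular_at f x" and "ratfun_eval f x = c"
proof -
  from assms obtain A B where AB: "f = Fract A B" "rat_poly_at B x \<noteq> 0"
    "c = rat_poly_at A x / rat_poly_at B x"
    by (auto simp: ratfun_value_def)
  then have "B \<noteq> 0" by auto
  then obtain d where d: "A = fst (normalize_quot (A, B)) * d" "B = snd (normalize_quot (A, B)) * d"
    by (rule normalize_quotE)
  have q: "quot_of_fract f = normalize_quot (A, B)"
    using quot_of_fract_quot_to_fract[of "(A, B)"] by (simp add: AB quot_to_fract_def)
  have A: "rat_poly_at A x = rat_poly_at (fst (quot_of_fract f)) x * rat_poly_at d x"
    unfolding q by (subst d(1)) (rule rat_poly_at_mult)
  have B: "rat_poly_at B x = rat_poly_at (snd (quot_of_fract f)) x * rat_poly_at d x"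
    unfolding q by (subst d(2)) (rule rat_poly_at_mult)
  show "ratfun_regular_at f x" using AB(2) B by (simp add: ratfun_regular_at_def)
  show "ratfun_eval f x = c" using AB(2,3) A B by (simp add: ratfun_eval_def)
qed

lemma ratfun_value_to_fract: "ratfun_value x (to_fract A) (rat_poly_at A x)"
  unfolding ratfun_value_def by (intro exI[of _ A] exI[of _ 1]) (simp add: to_fract_def)

lemma ratfun_value_0: "ratfun_value x 0 0"
  using ratfun_value_to_fract[of x 0] by simp

lemma ratfun_value_1: "ratfun_value x 1 1"
  using ratfun_value_to_fract[of x 1] by simp

lemma ratfun_value_qvar: "ratfun_value x qvar x"
  using ratfun_value_to_fract[of x "[:0, 1:]"] by (simp add: qvar_def map_poly_pCons)

lemma ratfun_value_add:
  assumes "ratfun_value x f c" and "ratfun_value x g d"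
  shows "ratfun_value x (f + g) (c + d)"
proof -
  from assms obtain A B A' B' where *: "f = Fract A B" "rat_poly_at B x \<noteq> 0"
    "c = rat_poly_at A x / rat_poly_at B x" "g = Fract A' B'" "rat_poly_at B' x \<noteq> 0"
    "d = rat_poly_at A' x / rat_poly_at B' x"
    unfolding ratfun_value_def by blast
  from * have "B \<noteq> 0" "B' \<noteq> 0" by auto
  with * show ?thesis
    unfolding ratfun_value_def
    by (intro exI[of _ "A * B' + A' * B"] exI[of _ "B * B'"])
      (simp add: rat_poly_at_mult rat_poly_at_add add_frac_eq)
qed

lemma ratfun_value_mult:
  assumes "ratfun_value x f c" and "ratfun_value x g d"
  shows "ratfun_value x (f * g) (c * d)"
proof -
  from assms obtain A B A' B' where *: "f = Fract A B" "rat_poly_at B x \<noteq> 0"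
    "c = rat_poly_at A x / rat_poly_at B x" "g = Fract A' B'" "rat_poly_at B' x \<noteq> 0"
    "d = rat_poly_at A' x / rat_poly_at B' x"
    unfolding ratfun_value_def by blast
  then show ?thesis
    unfolding ratfun_value_def
    by (intro exI[of _ "A * A'"] exI[of _ "B * B'"]) (simp add: rat_poly_at_mult)
qed

lemma ratfun_value_minus:
  assumes "ratfun_value x f c"
  shows "ratfun_value x (- f) (- c)"
proof -
  have "to_fract [:-1:] = (-1 :: rat poly fract)"
    by (simp add: to_fract_def One_fract_def one_pCons)
  with ratfun_value_mult[OF ratfun_value_to_fract[of x "[:-1:]"] assms] show ?thesis
    by (simp add: map_poly_pCons)
qed

lemma ratfun_value_divide:
  assumes "ratfun_value x f c" and "ratfun_value x g d" and "d \<noteq> 0"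
  shows "ratfun_value x (f / g) (c / d)"
proof -
  from assms(2,3) obtain A B where *: "g = Fract A B" "rat_poly_at B x \<noteq> 0"
    "d = rat_poly_at A x / rat_poly_at B x" "rat_poly_at A x \<noteq> 0"
    unfolding ratfun_value_def by auto
  then have "ratfun_value x (inverse g) (inverse d)"
    unfolding ratfun_value_def by (intro exI[of _ B] exI[of _ A]) simp
  from ratfun_value_mult[OF assms(1) this] show ?thesis by (simp add: divide_inverse)
qed

lemma ratfun_value_power: "ratfun_value x f c \<Longrightarrow> ratfun_value x (f ^ n) (c ^ n)"
  by (induction n) (auto intro: ratfun_value_1 ratfun_value_mult)

lemma ratfun_value_sum:
  "(\<And>i. i \<in> I \<Longrightarrow> ratfun_value x (f i) (c i)) \<Longrightarrow> ratfun_value x (sum f I) (sum c I)"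
  by (induction I rule: infinite_finite_induct) (auto intro: ratfun_value_0 ratfun_value_add)

lemma ratfun_value_prod:
  "(\<And>i. i \<in> I \<Longrightarrow> ratfun_value x (f i) (c i)) \<Longrightarrow> ratfun_value x (prod f I) (prod c I)"
  by (induction I rule: infinite_finite_induct) (auto intro: ratfun_value_1 ratfun_value_mult)

lemma ratfun_value_qnat: "ratfun_value x (qnat qvar n) (qnat x n)"
  unfolding qnat_def by (intro ratfun_value_sum ratfun_value_power ratfun_value_qvar)

lemma ratfun_value_qfact: "ratfun_value x (qfact qvar n) (qfact x n)"
  unfolding qfact_def by (intro ratfun_value_prod ratfun_value_qnat)

lemma ratfun_value_qangle: "ratfun_value x (qangle qvar a) (qangle x a)"
  by (simp add: qangle_def ratfun_value_qnat ratfun_value_0 ratfun_value_minus)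

section \<open>Regularity at \<open>z\<close> of the rational functions in the recursion\<close>

context prime_root_of_unity
begin

lemma ratfun_value_qE:
  assumes "m < p"
  shows "ratfun_value z (qE qvar m) (qE z m)"
  unfolding qE_def
proof (intro ratfun_value_sum ratfun_value_divide ratfun_value_mult ratfun_value_power
    ratfun_value_qvar ratfun_value_qnat ratfun_value_minus ratfun_value_1)
  show "qnat z n ^ 3 \<noteq> 0" if "n \<in> {1..m}" for n
    using that assms by (simp add: qnat_nonzero)
qed

lemma ratfun_value_qh: "ratfun_value z (qh qvar m) (qh z m)"
  unfolding qh_def
  by (intro ratfun_value_divide ratfun_value_mult ratfun_value_power
    ratfun_value_qnat ratfun_value_qfact) (use p_gt_2 in \<open>simp add: qnat_nonzero\<close>)

lemma ratfun_value_qrho: "ratfun_value z (qrho qvar k m) (qrho z k m)"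
  unfolding qrho_def
  by (intro ratfun_value_divide ratfun_value_mult ratfun_value_power ratfun_value_add
    ratfun_value_qangle) (use p_gt_2 in \<open>simp add: qangle_nonzero\<close>)

lemma ratfun_value_qT:
  assumes "\<bar>2 * int m - 2 * int k - 1\<bar> < int p"
  shows "ratfun_value z (qT qvar k m) (qT z k m)"
proof -
  \<comment> \<open>The number is odd.\<close>
  have "2 * int m - 2 * int k - 1 \<noteq> 0" by presburger
  with assms show ?thesis
    unfolding qT_def by (intro ratfun_value_divide ratfun_value_qangle qangle_nonzero)
qed

text \<open>The recursion never increases \<open>m + k\<close> or lowers \<open>m\<close>, so both
  bounds persist. They keep the index in the denominator of \<open>qT\<close> strictly between
  \<open>- p\<close> and \<open>p\<close>; in particular \<open>m \<ge> 1\<close> excludes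
  \<open>- p\<close> itself.\<close>

lemma ratfun_value_qU:
  assumes "m \<ge> 1" and "2 * (m + k) \<le> p + 1"
  shows "ratfun_value z (fst (qU qvar k m)) (fst (qU z k m))"
    and "ratfun_value z (snd (qU qvar k m)) (snd (qU z k m))"
proof -
  have "ratfun_value z (fst (qU qvar k m)) (fst (qU z k m)) \<and>
    ratfun_value z (snd (qU qvar k m)) (snd (qU z k m))"
    using assms
  proof (induction k arbitrary: m)
    case 0
    then have "m < p" using p_gt_2 by simp
    then show ?case
      by (simp add: ratfun_value_mult ratfun_value_qE ratfun_value_qh)
  next
    case (Suc k)
    from Suc.prems have "\<bar>2 * int m - 2 * int k - 1\<bar> < int p" by presburger
    then have "ratfun_value z (qT qvar k m) (qT z k m)" by (rule ratfun_value_qT)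
    with Suc.IH[of m] Suc.IH[of "Suc m"] Suc.prems show ?case
      by (simp add: ratfun_value_mult ratfun_value_add ratfun_value_qrho)
  qed
  then show "ratfun_value z (fst (qU qvar k m)) (fst (qU z k m))"
    "ratfun_value z (snd (qU qvar k m)) (snd (qU z k m))" by auto
qed

section \<open>The pair at \<open>m = k = r\<close> and the conclusion\<close>

lemma qU_central:
  assumes M: "p = 2 * M + 1" and "p \<ge> 11" and r: "r = (p + 1) div 4"
  shows "\<exists>c. c \<noteq> 0 \<and> qU z r r = (c * fst (qU z 0 M), c * snd (qU z 0 M))"
proof (cases "even M")
  case True
  then have "4 * r \<le> p - 1" "M - r = r" "r < p" using M r by presburger+
  with qU_diagonal[OF M, of r] p_unit_dcoeff[of r] reduces_nonzero show ?thesis by metis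
next
  case False
  then have "4 * r = p + 1" "M + 1 - r = r" using M r by presburger+
  with qU_superdiagonal[OF M, of r] p_unit_wcoeff[OF \<open>p \<ge> 11\<close>, of r] reduces_nonzero
  show ?thesis by (metis order_refl)
qed

end

theorem proposition4p2:
  fixes p r :: nat and z :: complex
  assumes "prime p" and "p \<ge> 11"
    and "z = exp (2 * complex_of_real pi * \<i> / of_nat p)"
    and "r = (p + 1) div 4"
  shows "ratfun_regular_at (fst (qU qvar r r)) z \<and>
         ratfun_regular_at (snd (qU qvar r r)) z \<and>
         ratfun_regular_at (qE qvar ((p - 1) div 2)) z \<and>
         ratfun_eval (snd (qU qvar r r)) z \<noteq> 0 \<and>
         ratfun_eval (fst (qU qvar r r)) z / ratfun_eval (snd (qU qvar r r)) z =
         ratfun_eval (qE qvar ((p - 1) div 2)) z"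
proof -
  have odd: "odd p" using prime_odd_nat[of p] assms by simp
  interpret prime_root_of_unity p z
    using assms odd by unfold_locales
  define M where "M = (p - 1) div 2"
  have M: "p = 2 * M + 1" using odd by (auto simp: M_def elim!: oddE)
  obtain c where c: "c \<noteq> 0" "qU z r r = (c * (qh z M * qE z M), c * qh z M)"
    using qU_central[OF M \<open>p \<ge> 11\<close> assms(4)] by auto
  have h: "qh z M \<noteq> 0" by (rule qh_nonzero) (simp add: M)
  have r: "r \<ge> 1" "2 * (r + r) \<le> p + 1" using assms by auto
  have "ratfun_value z (fst (qU qvar r r)) (c * (qh z M * qE z M))"
    and "ratfun_value z (snd (qU qvar r r)) (c * qh z M)"
    using ratfun_value_qU[OF r] by (simp_all add: c)
  moreover have "ratfun_value z (qE qvar M) (qE z M)"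
    by (rule ratfun_value_qE) (simp add: M)
  ultimately show ?thesis
    \<comment> \<open>The common factor \<open>c * qh z M\<close> is nonzero and cancels in the
      quotient.\<close>
    using c h unfolding M_def[symmetric] by (simp add: ratfun_value_eval)
qed

end
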